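(* Let $(\mathcal{H},\Lambda)$ be a Hopf Galois order setting with $L=\mathrm{Frac}(\Lambda)$, and let $F$ be an $\mathcal{H}$-Galois $\Lambda$-order. If $V$ is any finite-dimensional left (respectively right) $L$-subspace of $L\#\mathcal{H}$, then $V\cap F$ is a finitely generated left (respectively right) $\Lambda$-module.
   Context: Let $\Bbbk$ be an arbitrary field; all algebras are over $\Bbbk$ and $\otimes=\otimes_{\Bbbk}$. A Hopf Galois order setting (or setting) is a pair $(\mathcal{H},\Lambda)$ where $\mathcal{H}$ is a left coideal subalgebra (a subalgebra with $\Delta(\mathcal{H})\subset\tilde{\mathcal{H}}\otimes\mathcal{H}$) of a Hopf algebra $\tilde{\mathcal{H}}$ (which is part of the data) with comultiplication $\Delta(x)=x_{(1)}\otimes x_{(2)}$, counit $\varepsilon$ and invertible antipode $S$, and $\Lambda$ is a left $\tilde{\mathcal{H}}$-module algebra (action denoted $x\triangleright a$) such that (i) $\Lambda$ is a noetherian (commutative) integral domain; (ii) the action of $\tilde{\mathcal{H}}$ on $\Lambda$ extends to an action on the field of fractions $L=\mathrm{Frac}(\Lambda)$ (also denoted $\triangleright$); (iii) $\Lambda$ is faithful as a left module over the smash product $\Lambda\#\mathcal{H}$. The smash product $A\#\mathcal{H}$ (for $A=\Lambda$ or $L$) is the algebra containing $A$ and $\mathcal{H}$ as subalgebras such that $A\otimes\mathcal{H}\to A\#\mathcal{H}$, $a\otimes x\mapsto ax$, is a vector space isomorphism and $xa=(x_{(1)}\triangleright a)x_{(2)}$ for $x\in\mathcal{H}$, $a\in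 A$. For $X\in L\#\tilde{\mathcal{H}}$, $\hat X$ denotes the corresponding linear endomorphism of $L$, determined by $\hat f(g)=fg$ for $f,g\in L$ and $\hat x(f)=x\triangleright f$ for $x\in\tilde{\mathcal{H}}$. An $\mathcal{H}$-Galois $\Lambda$-order is a subalgebra $F\subset L\#\mathcal{H}$ such that $\Lambda\subset F$, $LF=L\#\mathcal{H}$, and $\hat X(\Lambda)\subset\Lambda$ for all $X\in F$. *)

theory Defs
  imports
    "HOL-Computational_Algebra.Computational_Algebra"
    "HOL-Library.Poly_Mapping"
begin

text \<open>
  Vector spaces are given by a type for the vectors and a scalar multiplication, as in
  \<^theory>\<open>HOL.Modules\<close>. All algebras are associative and unital, and subalgebras contain the unit.
\<close>

locale algebra_over = vector_space scale
  for scale :: "'k::field \<Rightarrow> 'h::ring_1 \<Rightarrow> 'h" +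
  assumes scale_mult_left: "scale c x * y = scale c (x * y)"
    and scale_mult_right: "x * scale c y = scale c (x * y)"

locale algebra_hom = A: algebra_over scaleA + B: algebra_over scaleB + Vector_Spaces.linear scaleA scaleB f
  for scaleA :: "'k::field \<Rightarrow> 'a::ring_1 \<Rightarrow> 'a"
    and scaleB :: "'k \<Rightarrow> 'b::ring_1 \<Rightarrow> 'b"
    and f :: "'a \<Rightarrow> 'b" +
  assumes hom_one: "f 1 = 1"
    and hom_mult: "f (x * y) = f x * f y"

definition subalgebra :: "('k::field \<Rightarrow> 'h::ring_1 \<Rightarrow> 'h) \<Rightarrow> 'h set \<Rightarrow> bool" where
  "subalgebra scale B \<longleftrightarrow>
     module.subspace scale B \<and> 1 \<in> B \<and> (\<forall>x\<in>B. \<forall>y\<in>B. x * y \<in> B)"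

definition finitely_generated ::
    "('r::comm_ring_1 \<Rightarrow> 'm::ab_group_add \<Rightarrow> 'm) \<Rightarrow> 'm set \<Rightarrow> bool" where
  "finitely_generated scale M \<longleftrightarrow> (\<exists>B. finite B \<and> M = module.span scale B)"

definition finite_dim_subspace ::
    "('r::field \<Rightarrow> 'm::ab_group_add \<Rightarrow> 'm) \<Rightarrow> 'm set \<Rightarrow> bool" where
  "finite_dim_subspace scale V \<longleftrightarrow>
     (\<exists>B. finite B \<and> \<not> module.dependent scale B \<and> V = module.span scale B)"

definition noetherian :: "'a::comm_ring_1 itself \<Rightarrow> bool" where
  "noetherian _ \<longleftrightarrow>
     (\<forall>I :: 'a set. module.subspace (*) I \<longrightarrow> finitely_generated (*) I)"

text \<open>
  An element of a tensor product over the field \<open>'k\<close> is represented by an element of the free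
  vector space on the set of tuples, and two representatives describe the same tensor iff they
  are congruent modulo the subspace spanned by the multilinearity relations. A linear map into a
  tensor product, such as a comultiplication, is given by a choice of a representative of each
  of its values; all of its properties are then stated up to this congruence.
\<close>

definition formal_scale :: "'k::field \<Rightarrow> ('x \<Rightarrow>\<^sub>0 'k) \<Rightarrow> ('x \<Rightarrow>\<^sub>0 'k)" where
  "formal_scale c t = Poly_Mapping.map ((*) c) t"

text \<open>The linear extension of a map defined on the basis of a free vector space; for
  \<open>f = (\<lambda>(x, y). g x y)\<close> with \<open>g\<close> bilinear it is the linear map \<open>x \<otimes> y \<mapsto> g x y\<close>. In Sweedler
  notation, \<open>formal_extend scale f (\<Delta> x)\<close> is the sum of the \<open>f (x\<^sub>(\<^sub>1\<^sub>), x\<^sub>(\<^sub>2\<^sub>))\<close>.\<close>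

definition formal_extend ::
    "('k::field \<Rightarrow> 'w::ab_group_add \<Rightarrow> 'w) \<Rightarrow> ('x \<Rightarrow> 'w) \<Rightarrow> ('x \<Rightarrow>\<^sub>0 'k) \<Rightarrow> 'w" where
  "formal_extend scale f t =
     (\<Sum>p\<in>Poly_Mapping.keys t. scale (Poly_Mapping.lookup t p) (f p))"

definition tensor_relations ::
    "('k::field \<Rightarrow> 'u::ab_group_add \<Rightarrow> 'u) \<Rightarrow> ('k \<Rightarrow> 'v::ab_group_add \<Rightarrow> 'v) \<Rightarrow>
     ('u \<times> 'v \<Rightarrow>\<^sub>0 'k) set" where
  "tensor_relations sU sV =
     (let e = (\<lambda>u v. Poly_Mapping.single (u, v) 1) in
      module.span formal_scale
       ({e (u + u') v - (e u v + e u' v) | u u' v. True}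
        \<union> {e u (v + v') - (e u v + e u v') | u v v'. True}
        \<union> {e (sU c u) v - formal_scale c (e u v) | c u v. True}
        \<union> {e u (sV c v) - formal_scale c (e u v) | c u v. True}))"

definition tensor_eq ::
    "('k::field \<Rightarrow> 'u::ab_group_add \<Rightarrow> 'u) \<Rightarrow> ('k \<Rightarrow> 'v::ab_group_add \<Rightarrow> 'v) \<Rightarrow>
     ('u \<times> 'v \<Rightarrow>\<^sub>0 'k) \<Rightarrow> ('u \<times> 'v \<Rightarrow>\<^sub>0 'k) \<Rightarrow> bool" where
  "tensor_eq sU sV s t \<longleftrightarrow> s - t \<in> tensor_relations sU sV"

definition tensor3_relations ::
    "('k::field \<Rightarrow> 'u::ab_group_add \<Rightarrow> 'u) \<Rightarrow> ('u \<times> 'u \<times> 'u \<Rightarrow>\<^sub>0 'k) set" where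
  "tensor3_relations sU =
     (let e = (\<lambda>u v w. Poly_Mapping.single (u, v, w) 1) in
      module.span formal_scale
       ({e (u + u') v w - (e u v w + e u' v w) | u u' v w. True}
        \<union> {e u (v + v') w - (e u v w + e u v' w) | u v v' w. True}
        \<union> {e u v (w + w') - (e u v w + e u v w') | u v w w'. True}
        \<union> {e (sU c u) v w - formal_scale c (e u v w) | c u v w. True}
        \<union> {e u (sU c v) w - formal_scale c (e u v w) | c u v w. True}
        \<union> {e u v (sU c w) - formal_scale c (e u v w) | c u v w. True}))"

definition tensor3_eq ::
    "('k::field \<Rightarrow> 'u::ab_group_add \<Rightarrow> 'u) \<Rightarrow>
     ('u \<times> 'u \<times> 'u \<Rightarrow>\<^sub>0 'k) \<Rightarrow> ('u \<times> 'u \<times> 'u \<Rightarrow>\<^sub>0 'k) \<Rightarrow> bool" where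
  "tensor3_eq sU s t \<longleftrightarrow> s - t \<in> tensor3_relations sU"

text \<open>The product \<open>(x \<otimes> y) (x' \<otimes> y') = x x' \<otimes> y y'\<close>. (The multiplication that the library
  puts on \<open>\<Rightarrow>\<^sub>0\<close> is a convolution with respect to addition of keys and is not used here.)\<close>

definition tensor_mult ::
    "('u::ring_1 \<times> 'u \<Rightarrow>\<^sub>0 'k::field) \<Rightarrow> ('u \<times> 'u \<Rightarrow>\<^sub>0 'k) \<Rightarrow> ('u \<times> 'u \<Rightarrow>\<^sub>0 'k)" where
  "tensor_mult s t =
     formal_extend formal_scale
       (\<lambda>(x, y). formal_extend formal_scale
          (\<lambda>(x', y'). Poly_Mapping.single (x * x', y * y') 1) t) s"

locale hopf_algebra = algebra_over scale
  for scale :: "'k::field \<Rightarrow> 'h::ring_1 \<Rightarrow> 'h" +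
  fixes \<Delta> :: "'h \<Rightarrow> ('h \<times> 'h \<Rightarrow>\<^sub>0 'k)"
    and \<epsilon> :: "'h \<Rightarrow> 'k"
    and S :: "'h \<Rightarrow> 'h"
  assumes comult_add: "tensor_eq scale scale (\<Delta> (x + y)) (\<Delta> x + \<Delta> y)"
    and comult_scale: "tensor_eq scale scale (\<Delta> (scale c x)) (formal_scale c (\<Delta> x))"
    and comult_one: "tensor_eq scale scale (\<Delta> 1) (Poly_Mapping.single (1, 1) 1)"
    and comult_mult: "tensor_eq scale scale (\<Delta> (x * y)) (tensor_mult (\<Delta> x) (\<Delta> y))"
    and counit_hom: "algebra_hom scale (*) \<epsilon>"
    and coassoc:
      "tensor3_eq scale
         (formal_extend formal_scale
            (\<lambda>(y, z). formal_extend formal_scale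
               (\<lambda>(y1, y2). Poly_Mapping.single (y1, y2, z) 1) (\<Delta> y)) (\<Delta> x))
         (formal_extend formal_scale
            (\<lambda>(y, z). formal_extend formal_scale
               (\<lambda>(z1, z2). Poly_Mapping.single (y, z1, z2) 1) (\<Delta> z)) (\<Delta> x))"
    and counit_left: "formal_extend scale (\<lambda>(y, z). scale (\<epsilon> y) z) (\<Delta> x) = x"
    and counit_right: "formal_extend scale (\<lambda>(y, z). scale (\<epsilon> z) y) (\<Delta> x) = x"
    and antipode_linear: "Vector_Spaces.linear scale scale S"
    and antipode_left: "formal_extend scale (\<lambda>(y, z). S y * z) (\<Delta> x) = scale (\<epsilon> x) 1"
    and antipode_right: "formal_extend scale (\<lambda>(y, z). y * S z) (\<Delta> x) = scale (\<epsilon> x) 1"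

definition left_coideal_subalgebra ::
    "('k::field \<Rightarrow> 'h::ring_1 \<Rightarrow> 'h) \<Rightarrow> ('h \<Rightarrow> ('h \<times> 'h \<Rightarrow>\<^sub>0 'k)) \<Rightarrow> 'h set \<Rightarrow> bool" where
  "left_coideal_subalgebra scale \<Delta> H \<longleftrightarrow>
     subalgebra scale H \<and>
     (\<forall>x\<in>H. \<exists>t. Poly_Mapping.keys t \<subseteq> UNIV \<times> H \<and> tensor_eq scale scale (\<Delta> x) t)"

locale module_algebra = hopf_algebra scaleH \<Delta> \<epsilon> S + A: algebra_over scaleA
  for scaleH :: "'k::field \<Rightarrow> 'h::ring_1 \<Rightarrow> 'h"
    and \<Delta> :: "'h \<Rightarrow> ('h \<times> 'h \<Rightarrow>\<^sub>0 'k)"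
    and \<epsilon> :: "'h \<Rightarrow> 'k"
    and S :: "'h \<Rightarrow> 'h"
    and scaleA :: "'k \<Rightarrow> 'a::ring_1 \<Rightarrow> 'a" +
  fixes act :: "'h \<Rightarrow> 'a \<Rightarrow> 'a"
  assumes act_linear_left: "Vector_Spaces.linear scaleH scaleA (\<lambda>x. act x a)"
    and act_linear_right: "Vector_Spaces.linear scaleA scaleA (act x)"
    and act_one_left: "act 1 a = a"
    and act_mult_left: "act (x * y) a = act x (act y a)"
    and act_one_right: "act x 1 = scaleA (\<epsilon> x) 1"
    and act_mult_right:
      "act x (a * b) = formal_extend scaleA (\<lambda>(y, z). act y a * act z b) (\<Delta> x)"

text \<open>The linear map \<open>a \<otimes> x \<mapsto> a x\<close> into an algebra in which \<open>A\<close> and the Hopf algebra are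
  embedded by \<open>\<iota>A\<close> and \<open>\<iota>H\<close>.\<close>

definition smash_map ::
    "('k::field \<Rightarrow> 's::ring_1 \<Rightarrow> 's) \<Rightarrow> ('a \<Rightarrow> 's) \<Rightarrow> ('h \<Rightarrow> 's) \<Rightarrow> ('a \<times> 'h \<Rightarrow>\<^sub>0 'k) \<Rightarrow> 's" where
  "smash_map scaleX \<iota>A \<iota>H = formal_extend scaleX (\<lambda>(a, x). \<iota>A a * \<iota>H x)"

text \<open>The ring type \<open>'s\<close>, with scalar multiplication \<open>scaleX\<close>, is the smash product of the
  module algebra \<open>'a\<close> with the whole Hopf algebra \<open>'h\<close>.\<close>

locale smash_product = module_algebra scaleH \<Delta> \<epsilon> S scaleA act +
  \<iota>A: algebra_hom scaleA scaleX \<iota>A + \<iota>H: algebra_hom scaleH scaleX \<iota>H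
  for scaleH :: "'k::field \<Rightarrow> 'h::ring_1 \<Rightarrow> 'h"
    and \<Delta> :: "'h \<Rightarrow> ('h \<times> 'h \<Rightarrow>\<^sub>0 'k)"
    and \<epsilon> :: "'h \<Rightarrow> 'k"
    and S :: "'h \<Rightarrow> 'h"
    and scaleA :: "'k \<Rightarrow> 'a::ring_1 \<Rightarrow> 'a"
    and act :: "'h \<Rightarrow> 'a \<Rightarrow> 'a"
    and scaleX :: "'k \<Rightarrow> 's::ring_1 \<Rightarrow> 's"
    and \<iota>A :: "'a \<Rightarrow> 's"
    and \<iota>H :: "'h \<Rightarrow> 's" +
  assumes inj_\<iota>A: "inj \<iota>A"
    and inj_\<iota>H: "inj \<iota>H"
    and smash_map_eq_iff:
      "smash_map scaleX \<iota>A \<iota>H s = smash_map scaleX \<iota>A \<iota>H t \<longleftrightarrow> tensor_eq scaleA scaleH s t"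
    and smash_map_surj: "surj (smash_map scaleX \<iota>A \<iota>H)"
    and smash_commute:
      "\<iota>H x * \<iota>A a = formal_extend scaleX (\<lambda>(y, z). \<iota>A (act y a) * \<iota>H z) (\<Delta> x)"

text \<open>For subalgebras \<open>B\<close> and \<open>H\<close>, the smash product \<open>B # H\<close> as a subset of the ambient smash
  product, namely the image of \<open>B \<otimes> H\<close>; over a field, \<open>B \<otimes> H\<close> embeds into the ambient tensor
  product.\<close>

definition smash_subset ::
    "('k::field \<Rightarrow> 's::ring_1 \<Rightarrow> 's) \<Rightarrow> ('a \<Rightarrow> 's) \<Rightarrow> ('h \<Rightarrow> 's) \<Rightarrow> 'a set \<Rightarrow> 'h set \<Rightarrow> 's set" where
  "smash_subset scaleX \<iota>A \<iota>H B H =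
     smash_map scaleX \<iota>A \<iota>H ` {t. Poly_Mapping.keys t \<subseteq> B \<times> H}"

text \<open>The endomorphism of \<open>A\<close> attached to \<open>X\<close>: if \<open>X\<close> is the image of the sum of the
  \<open>a\<^sub>i \<otimes> x\<^sub>i\<close>, it maps \<open>g\<close> to the sum of the \<open>a\<^sub>i (x\<^sub>i \<triangleright> g)\<close>. The value does not depend on the
  chosen representative, see \<open>smash_hat_smash_map\<close> below.\<close>

definition smash_hat ::
    "('k::field \<Rightarrow> 'a::ring_1 \<Rightarrow> 'a) \<Rightarrow> ('h \<Rightarrow> 'a \<Rightarrow> 'a) \<Rightarrow> ('k \<Rightarrow> 's::ring_1 \<Rightarrow> 's) \<Rightarrow>
     ('a \<Rightarrow> 's) \<Rightarrow> ('h \<Rightarrow> 's) \<Rightarrow> 's \<Rightarrow> 'a \<Rightarrow> 'a" where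
  "smash_hat scaleA act scaleX \<iota>A \<iota>H X g =
     formal_extend scaleA (\<lambda>(a, x). a * act x g) (SOME t. smash_map scaleX \<iota>A \<iota>H t = X)"

lemma lookup_formal_scale [simp]:
  "Poly_Mapping.lookup (formal_scale c t) p = c * Poly_Mapping.lookup t p"
  by (simp add: formal_scale_def Poly_Mapping.map.rep_eq when_def)

lemma module_formal_scale: "module (formal_scale :: 'k::field \<Rightarrow> ('x \<Rightarrow>\<^sub>0 'k) \<Rightarrow> _)"
  by unfold_locales (auto intro!: poly_mapping_eqI simp: lookup_add algebra_simps)

context vector_space
begin

lemma formal_extend_superset:
  assumes "finite K" "Poly_Mapping.keys t \<subseteq> K"
  shows "formal_extend scale f t = (\<Sum>p\<in>K. scale (Poly_Mapping.lookup t p) (f p))"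
  unfolding formal_extend_def
  by (rule sum.mono_neutral_left) (use assms in \<open>auto simp: in_keys_iff\<close>)

lemma formal_extend_single [simp]:
  "formal_extend scale f (Poly_Mapping.single p c) = scale c (f p)"
  by (subst formal_extend_superset[of "{p}"]) auto

lemma linear_formal_extend: "Vector_Spaces.linear formal_scale scale (formal_extend scale f)"
proof -
  have add: "formal_extend scale f (s + t) = formal_extend scale f s + formal_extend scale f t"
    for s t
  proof -
    let ?K = "Poly_Mapping.keys s \<union> Poly_Mapping.keys t"
    have "Poly_Mapping.keys (s + t) \<subseteq> ?K" by (rule keys_add)
    then show ?thesis
      by (simp add: formal_extend_superset[of ?K] lookup_add scale_left_distrib sum.distrib)
  qed
  have sc: "formal_extend scale f (formal_scale c t) = scale c (formal_extend scale f t)" for c t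
  proof -
    have "Poly_Mapping.keys (formal_scale c t) \<subseteq> Poly_Mapping.keys t"
      by (auto simp: in_keys_iff)
    then show ?thesis
      by (simp add: formal_extend_superset[of "Poly_Mapping.keys t"] scale_sum_right)
  qed
  interpret F: module "formal_scale :: 'a \<Rightarrow> ('c \<Rightarrow>\<^sub>0 'a) \<Rightarrow> _"
    by (rule module_formal_scale)
  show ?thesis
    by unfold_locales (auto simp: add sc F.scale_right_distrib F.scale_left_distrib)
qed

lemma formal_extend_tensor_eq:
  assumes "\<And>v. Vector_Spaces.linear sU scale (\<lambda>u. g u v)" and "\<And>u. Vector_Spaces.linear sV scale (g u)"
    and "tensor_eq sU sV s t"
  shows "formal_extend scale (\<lambda>(u, v). g u v) s = formal_extend scale (\<lambda>(u, v). g u v) t"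
proof -
  let ?E = "formal_extend scale (\<lambda>(u, v). g u v)"
  interpret E: Vector_Spaces.linear formal_scale scale ?E by (rule linear_formal_extend)
  have l: "g (u + u') v = g u v + g u' v" "g (sU c u) v = scale c (g u v)" for u u' v c
    using assms(1)[of v] by (auto simp: Vector_Spaces.linear_iff)
  have r: "g u (v + v') = g u v + g u v'" "g u (sV c v) = scale c (g u v)" for u v v' c
    using assms(2)[of u] by (auto simp: Vector_Spaces.linear_iff)
  have "?E x = 0" if "x \<in> tensor_relations sU sV" for x
    using that unfolding tensor_relations_def Let_def
    by (rule E.eq_0_on_span[rotated]) (auto simp: E.diff E.add E.scale l r)
  from this[of "s - t"] show ?thesis
    using assms(3) by (simp add: tensor_eq_def E.diff)
qed

end

context smash_product
begin

lemma smash_hat_smash_map: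
  "smash_hat scaleA act scaleX \<iota>A \<iota>H (smash_map scaleX \<iota>A \<iota>H t) g =
   formal_extend scaleA (\<lambda>(a, x). a * act x g) t"
proof -
  have "smash_map scaleX \<iota>A \<iota>H (SOME s. smash_map scaleX \<iota>A \<iota>H s = smash_map scaleX \<iota>A \<iota>H t)
      = smash_map scaleX \<iota>A \<iota>H t"
    by (rule someI) (rule refl)
  then have "tensor_eq scaleA scaleH
      (SOME s. smash_map scaleX \<iota>A \<iota>H s = smash_map scaleX \<iota>A \<iota>H t) t"
    by (simp only: smash_map_eq_iff)
  moreover have "Vector_Spaces.linear scaleA scaleA (\<lambda>a. a * act x g)" for x
    by unfold_locales (auto simp: A.scale_mult_left algebra_simps)
  moreover have "Vector_Spaces.linear scaleH scaleA (\<lambda>x. a * act x g)" for a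
    using act_linear_left[of g]
    by (auto simp: Vector_Spaces.linear_iff A.scale_mult_right distrib_left)
  ultimately show ?thesis
    unfolding smash_hat_def by (intro A.formal_extend_tensor_eq)
qed

lemma smash_hat_\<iota>A: "smash_hat scaleA act scaleX \<iota>A \<iota>H (\<iota>A f) g = f * g"
  using smash_hat_smash_map[of "Poly_Mapping.single (f, 1) 1" g]
  by (simp add: smash_map_def act_one_left \<iota>H.hom_one)

lemma smash_hat_\<iota>H: "smash_hat scaleA act scaleX \<iota>A \<iota>H (\<iota>H x) g = act x g"
  using smash_hat_smash_map[of "Poly_Mapping.single (1, x) 1" g]
  by (simp add: smash_map_def \<iota>A.hom_one)

end

text \<open>\<open>\<Lambda>\<close> is the type \<open>'a\<close>, and \<open>L\<close> is the library's field of fractions \<open>'a fract\<close>.\<close>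

text \<open>The structure of an algebra over \<open>'k\<close> that \<open>L\<close> inherits from \<open>\<Lambda>\<close>.\<close>

definition fract_scale :: "('k::field \<Rightarrow> 'a::idom \<Rightarrow> 'a) \<Rightarrow> 'k \<Rightarrow> 'a fract \<Rightarrow> 'a fract" where
  "fract_scale scale\<Lambda> c f = to_fract (scale\<Lambda> c 1) * f"

text \<open>
  \<open>'h\<close> is the ambient Hopf algebra, \<open>H\<close> the coideal subalgebra, and \<open>'s\<close> the smash product of
  \<open>L\<close> with \<open>'h\<close>. The last assumption says that \<open>\<Lambda>\<close> is a faithful module over
  \<open>\<Lambda> # H\<close>, whose action on \<open>\<Lambda>\<close> is the restriction of the action of \<open>L # H\<close> on \<open>L\<close>.
\<close>

locale hopf_galois_setting =
  base: module_algebra scaleH \<Delta> \<epsilon> S scale\<Lambda> act +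
  smash_product scaleH \<Delta> \<epsilon> S "fract_scale scale\<Lambda>" actL scaleX \<iota>L \<iota>H
  for scaleH :: "'k::field \<Rightarrow> 'h::ring_1 \<Rightarrow> 'h"
    and \<Delta> :: "'h \<Rightarrow> ('h \<times> 'h \<Rightarrow>\<^sub>0 'k)"
    and \<epsilon> :: "'h \<Rightarrow> 'k"
    and S :: "'h \<Rightarrow> 'h"
    and H :: "'h set"
    and scale\<Lambda> :: "'k \<Rightarrow> 'a::idom \<Rightarrow> 'a"
    and act :: "'h \<Rightarrow> 'a \<Rightarrow> 'a"
    and actL :: "'h \<Rightarrow> 'a fract \<Rightarrow> 'a fract"
    and scaleX :: "'k \<Rightarrow> 's::ring_1 \<Rightarrow> 's"
    and \<iota>L :: "'a fract \<Rightarrow> 's"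
    and \<iota>H :: "'h \<Rightarrow> 's" +
  assumes antipode_bij: "bij S"
    and coideal_subalgebra: "left_coideal_subalgebra scaleH \<Delta> H"
    and noetherian_\<Lambda>: "noetherian TYPE('a)"
    and actL_extends: "actL x (to_fract a) = to_fract (act x a)"
    and faithful:
      "\<lbrakk>X \<in> smash_subset scaleX \<iota>L \<iota>H (range to_fract) H;
        \<And>a. smash_hat (fract_scale scale\<Lambda>) actL scaleX \<iota>L \<iota>H X (to_fract a) = 0\<rbrakk> \<Longrightarrow> X = 0"

definition galois_order ::
    "'h::ring_1 set \<Rightarrow> ('k::field \<Rightarrow> 'a::idom \<Rightarrow> 'a) \<Rightarrow> ('h \<Rightarrow> 'a fract \<Rightarrow> 'a fract) \<Rightarrow>
     ('k \<Rightarrow> 's::ring_1 \<Rightarrow> 's) \<Rightarrow> ('a fract \<Rightarrow> 's) \<Rightarrow> ('h \<Rightarrow> 's) \<Rightarrow> 's set \<Rightarrow> bool" where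
  "galois_order H scale\<Lambda> actL scaleX \<iota>L \<iota>H F \<longleftrightarrow>
     F \<subseteq> smash_subset scaleX \<iota>L \<iota>H UNIV H \<and>
     subalgebra scaleX F \<and>
     range (\<lambda>a. \<iota>L (to_fract a)) \<subseteq> F \<and>
     module.span (\<lambda>f X. \<iota>L f * X) F = smash_subset scaleX \<iota>L \<iota>H UNIV H \<and>
     (\<forall>X\<in>F. smash_hat (fract_scale scale\<Lambda>) actL scaleX \<iota>L \<iota>H X ` range to_fract
        \<subseteq> range to_fract)"

end

theory Submission
  imports Defs
begin

text \<open>
  Clearing denominators, faithfulness shows that \<open>X \<mapsto> hat X\<close> restricted to \<open>\<Lambda>\<close> is injective
  on \<open>L # H\<close>. Hence the \<open>L\<close>-linear functionals \<open>X \<mapsto> hat X a\<close> with \<open>a \<in> \<Lambda>\<close> separate the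
  points of a finite-dimensional left subspace \<open>V\<close>; on \<open>V \<inter> F\<close> they take values in \<open>\<Lambda>\<close>, so finitely
  many of them embed \<open>V \<inter> F\<close> into a finite power of the noetherian ring \<open>\<Lambda>\<close>.

  A finite-dimensional right subspace \<open>V\<close> lies in a finite-dimensional left subspace \<open>W\<close>, because
  \<open>x a = (x\<^sub>(\<^sub>1\<^sub>) \<triangleright> a) x\<^sub>(\<^sub>2\<^sub>)\<close>. As \<open>W \<inter> F\<close> is finitely generated on the left, a common
  denominator \<open>c\<close> moves it into a sum of finitely many \<open>\<Lambda> h\<close> with \<open>h\<close> in the Hopf algebra. By
  surjectivity of the antipode and \<open>a S(x) = S(x\<^sub>(\<^sub>1\<^sub>)) (x\<^sub>(\<^sub>2\<^sub>) \<triangleright> a)\<close>, each \<open>\<Lambda> h\<close> lies in a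
  finitely generated right \<open>\<Lambda>\<close>-module. Thus \<open>c (V \<inter> F)\<close>, which is isomorphic to \<open>V \<inter> F\<close> as a right
  module, is a submodule of a finitely generated right module.
\<close>

section \<open>Modules over a noetherian ring\<close>

lemma module_mult: "module ((*) :: 'a::comm_ring_1 \<Rightarrow> 'a \<Rightarrow> 'a)"
  by unfold_locales (simp_all add: algebra_simps)

text \<open>A relation instead of a linear functional, because below the coefficient at \<open>b\<close> of an
  element of the span of \<open>insert b B\<close> need not be unique.\<close>

lemma (in module) finitely_generated_if_relation:
  fixes R :: "'a \<Rightarrow> 'b \<Rightarrow> bool"
  assumes noeth: "noetherian TYPE('a)" and N: "subspace N"
    and total: "\<And>x. x \<in> N \<Longrightarrow> \<exists>r. R r x"
    and zero: "R 0 0"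
    and add: "\<And>r s x y. R r x \<Longrightarrow> R s y \<Longrightarrow> R (r + s) (x + y)"
    and scale: "\<And>c r x. R r x \<Longrightarrow> R (c * r) (c *s x)"
    and kernel: "finitely_generated scale {x \<in> N. R 0 x}"
  shows "finitely_generated scale N"
proof -
  interpret R: module "(*) :: 'a \<Rightarrow> 'a \<Rightarrow> 'a" by (rule module_mult)
  \<comment> \<open>The related coefficients form an ideal, finitely generated by noetherianity.
    Lifts of its generators together with generators of the kernel will generate
    \<open>N\<close>.\<close>
  have "R.subspace {r. \<exists>x\<in>N. R r x}"
    by (rule R.subspaceI)
      (use N zero add scale subspace_0 subspace_add subspace_scale in blast)+
  then have "finitely_generated (*) {r. \<exists>x\<in>N. R r x}"
    using noeth unfolding noetherian_def by blast
  then obtain B where B: "finite B" "{r. \<exists>x\<in>N. R r x} = R.span B"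
    unfolding finitely_generated_def by blast
  from kernel obtain C where C: "finite C" "{x \<in> N. R 0 x} = span C"
    unfolding finitely_generated_def by blast
  have "\<exists>x\<in>N. R r x" if "r \<in> B" for r
    using R.span_base[OF that] B(2) by blast
  then obtain g where g: "\<And>r. r \<in> B \<Longrightarrow> g r \<in> N \<and> R r (g r)" by metis
  have lift: "\<exists>y\<in>span (g ` B). R r y" if "r \<in> R.span B" for r
    using that
  proof (induction rule: R.span_induct_alt)
    case base
    then show ?case using zero span_zero by blast
  next
    case (step c r s)
    then obtain y where "y \<in> span (g ` B)" "R s y" by blast
    with step(1) show ?case
      by (intro bexI[of _ "c *s g r + y"] add scale) (auto simp: g span_add span_scale span_base)
  qed
  have gN: "span (g ` B) \<subseteq> N"
    by (rule span_minimal) (use g N in auto)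
  have CN: "span C \<subseteq> N" using C(2) by blast
  have "N = span (g ` B \<union> C)"
  proof
    show "span (g ` B \<union> C) \<subseteq> N"
      by (rule span_minimal) (use gN CN N span_superset[of C] span_superset[of "g ` B"] in auto)
    show "N \<subseteq> span (g ` B \<union> C)"
    proof
      fix x assume x: "x \<in> N"
      then obtain r where r: "R r x" using total by blast
      with x B(2) have "r \<in> R.span B" by blast
      then obtain y where y: "y \<in> span (g ` B)" "R r y" using lift by blast
      \<comment> \<open>Both \<open>x\<close> and \<open>y\<close> are related to \<open>r\<close>,
        so their difference is related to \<open>r + (-1) * r = 0\<close> and falls into the
        kernel.\<close>
      have "R 0 (x - y)" using add[OF r scale[OF y(2), of "-1"]] by simp
      moreover have "x - y \<in> N" using x y gN N subspace_diff by blast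
      ultimately have "x - y \<in> span C" using C(2) by blast
      then have "y + (x - y) \<in> span (g ` B \<union> C)"
        unfolding span_Un using y(1) by blast
      then show "x \<in> span (g ` B \<union> C)" by simp
    qed
  qed
  moreover have "finite (g ` B \<union> C)" using B(1) C(1) by simp
  ultimately show ?thesis
    unfolding finitely_generated_def by (intro exI[of _ "g ` B \<union> C"] conjI)
qed

lemma (in module) finitely_generated_zero: "finitely_generated scale {0}"
  unfolding finitely_generated_def by (rule exI[of _ "{}"]) simp

text \<open>Induction on the generators: the possible coefficients at \<open>b\<close> form an
  ideal, and the elements for which 0 is a possible coefficient form
  \<open>N \<inter> span B\<close>, covered by the induction hypothesis.\<close>

lemma (in module) finitely_generated_submodule:
  assumes noeth: "noetherian TYPE('a)" and B: "finite B"
    and N: "subspace N" "N \<subseteq> span B"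
  shows "finitely_generated scale N"
  using B N
proof (induction B arbitrary: N)
  case empty
  then have "N = {0}" using subspace_0 by auto
  then show ?case using finitely_generated_zero by simp
next
  case (insert b B)
  show ?case
  proof (rule finitely_generated_if_relation[OF noeth, where R = "\<lambda>r x. x - r *s b \<in> span B"])
    show "subspace N" by fact
    show "\<exists>r. x - r *s b \<in> span B" if "x \<in> N" for x
      using that insert.prems span_breakdown_eq by blast
    show "0 - 0 *s b \<in> span B" by (simp add: span_zero)
    show "(x + y) - (r + s) *s b \<in> span B"
      if "x - r *s b \<in> span B" "y - s *s b \<in> span B" for r s x y
      using span_add[OF that] by (simp add: algebra_simps)
    show "c *s x - (c * r) *s b \<in> span B" if "x - r *s b \<in> span B" for c r x
      using span_scale[OF that, of c] by (simp add: algebra_simps)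
    show "finitely_generated scale {x \<in> N. x - 0 *s b \<in> span B}"
    proof (rule insert.IH)
      have "{x \<in> N. x - 0 *s b \<in> span B} = N \<inter> span B" by auto
      then show "subspace {x \<in> N. x - 0 *s b \<in> span B}"
        using insert.prems(1) subspace_inter by simp
    qed auto
  qed
qed

text \<open>Generators of the image are values of \<open>f\<close> on elements of \<open>N\<close>;
  by injectivity these elements span \<open>N\<close>.\<close>

lemma (in module) finitely_generated_inj_image:
  assumes hom: "module_hom scale scale f" and "inj f"
    and fg: "finitely_generated scale (f ` N)" and N: "subspace N"
  shows "finitely_generated scale N"
proof -
  interpret f: module_hom scale scale f by fact
  obtain B where B: "finite B" "f ` N = span B" using fg unfolding finitely_generated_def by blast
  then have "B \<subseteq> f ` N" using span_superset by blast
  then obtain C where C: "C \<subseteq> N" "finite C" "B = f ` C"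
    using B(1) finite_subset_image by metis
  have "f ` N = f ` span C" using B C by (simp add: f.span_image)
  then have "N = span C" using \<open>inj f\<close> by (simp add: inj_image_eq_iff)
  with C(2) show ?thesis unfolding finitely_generated_def by (intro exI[of _ C] conjI)
qed

text \<open>Induction on \<open>card B\<close>. If \<open>M\<close> is nonzero, some
  \<open>\<phi> i\<close> does not vanish on it; its values on \<open>M\<close> form an ideal of the
  noetherian ring, and its kernel in \<open>M\<close> lies in the span of fewer vectors. Thus
  finitely many functionals of a possibly infinite family are used.\<close>

lemma (in vector_space) finitely_generated_lattice:
  fixes \<phi> :: "'i \<Rightarrow> 'b \<Rightarrow> 'a" and \<iota> :: "'r::idom \<Rightarrow> 'a"
  assumes noeth: "noetherian TYPE('r)"
    and \<iota>: "\<And>r s. \<iota> (r + s) = \<iota> r + \<iota> s" "\<And>r s. \<iota> (r * s) = \<iota> r * \<iota> s" "\<iota> 1 = 1"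
    and \<phi>: "\<And>i. Vector_Spaces.linear scale (*) (\<phi> i)"
    and B: "finite B" and M: "module.subspace (\<lambda>r. scale (\<iota> r)) M" "M \<subseteq> span B"
    and integral: "\<And>i x. x \<in> M \<Longrightarrow> \<phi> i x \<in> range \<iota>"
    and separating: "\<And>x. x \<in> M \<Longrightarrow> (\<And>i. \<phi> i x = 0) \<Longrightarrow> x = 0"
  shows "finitely_generated (\<lambda>r. scale (\<iota> r)) M"
  using B M integral separating
proof (induction "card B" arbitrary: B M rule: less_induct)
  case less
  interpret R: module "\<lambda>r. scale (\<iota> r)"
    by unfold_locales (simp_all add: \<iota> algebra_simps)
  have \<iota>0: "\<iota> 0 = 0" using \<iota>(1)[of 0 0] by (metis add_cancel_right_left add_0)
  show ?case
  proof (cases "M \<subseteq> {0}")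
    case True
    then have "M = {0}" using R.subspace_0[OF less.prems(2)] by auto
    then show ?thesis using R.finitely_generated_zero by simp
  next
    case False
    then obtain x where x: "x \<in> M" "x \<noteq> 0" by auto
    then obtain i where i: "\<phi> i x \<noteq> 0" using less.prems(5) by blast
    interpret \<phi>: Vector_Spaces.linear scale "(*)" "\<phi> i" by (rule \<phi>)
    have "x \<in> span B" using x less.prems(3) by blast
    then obtain b where b: "b \<in> B" "\<phi> i b \<noteq> 0" using \<phi>.eq_0_on_span i by blast
    \<comment> \<open>The projection along \<open>b\<close> onto the kernel of
      \<open>\<phi> i\<close>. It kills \<open>b\<close> and fixes the kernel, so the part of the
      kernel inside \<open>span B\<close> lies in the span of the images of the remaining
      vectors.\<close>
    define \<pi> where "\<pi> y = y - scale (\<phi> i y / \<phi> i b) b" for y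
    have \<pi>: "Vector_Spaces.linear scale scale \<pi>"
      unfolding \<pi>_def Vector_Spaces.linear_iff
      by (auto simp: vector_space_axioms \<phi>.add \<phi>.scale algebra_simps add_divide_distrib)
    interpret \<pi>: Vector_Spaces.linear scale scale \<pi> by (rule \<pi>)
    have "\<pi> b = 0" using b by (simp add: \<pi>_def)
    then have "\<pi> y \<in> span (\<pi> ` (B - {b}))" if "y \<in> B" for y
      using that by (cases "y = b") (auto simp: span_zero intro!: span_base)
    then have "\<pi> ` B \<subseteq> span (\<pi> ` (B - {b}))" by blast
    then have \<pi>B: "span (\<pi> ` B) \<subseteq> span (\<pi> ` (B - {b}))"
      by (rule span_minimal) simp
    show ?thesis
    proof (rule R.finitely_generated_if_relation[OF noeth, where R = "\<lambda>r x. \<phi> i x = \<iota> r"])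
      show "\<exists>r. \<phi> i y = \<iota> r" if "y \<in> M" for y
        using less.prems(4)[OF that] by blast
      show "finitely_generated (\<lambda>r. scale (\<iota> r)) {x \<in> M. \<phi> i x = \<iota> 0}"
      proof (rule less.hyps)
        have "card (\<pi> ` (B - {b})) \<le> card (B - {b})"
          using less.prems(1) by (intro card_image_le) auto
        also have "\<dots> < card B" using less.prems(1) b(1) by (rule card_Diff1_less)
        finally show "card (\<pi> ` (B - {b})) < card B" .
        show "finite (\<pi> ` (B - {b}))" using less.prems(1) by simp
        show "R.subspace {x \<in> M. \<phi> i x = \<iota> 0}"
          by (rule R.subspaceI)
            (auto simp: \<iota>0 \<phi>.add \<phi>.scale R.subspace_0 R.subspace_add R.subspace_scale less.prems(2))
        show "{x \<in> M. \<phi> i x = \<iota> 0} \<subseteq> span (\<pi> ` (B - {b}))"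
        proof safe
          fix y assume y: "y \<in> M" "\<phi> i y = \<iota> 0"
          then have "\<pi> y = y" by (simp add: \<pi>_def \<iota>0)
          moreover have "\<pi> y \<in> span (\<pi> ` B)"
            using y less.prems(3) by (auto simp: \<pi>.span_image)
          ultimately show "y \<in> span (\<pi> ` (B - {b}))" using \<pi>B by auto
        qed
      qed (use less.prems in auto)
    qed (use less.prems \<iota> \<iota>0 in \<open>auto simp: \<phi>.add \<phi>.scale\<close>)
  qed
qed

text \<open>Used both to bring the coefficients of an element of \<open>L # H\<close> into
  \<open>\<Lambda>\<close> and to bound left modules by right ones.\<close>

lemma common_denominator:
  fixes P :: "'a::idom fract set"
  assumes "finite P"
  shows "\<exists>c. c \<noteq> 0 \<and> (\<forall>f\<in>P. to_fract c * f \<in> range to_fract)"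
  using assms
proof (induction P)
  case empty
  show ?case by (intro exI[of _ 1]) simp
next
  case (insert f P)
  then obtain c where c: "c \<noteq> 0" "\<And>g. g \<in> P \<Longrightarrow> to_fract c * g \<in> range to_fract" by blast
  obtain a b where ab: "f = to_fract a / to_fract b" "b \<noteq> 0"
    by (cases f) (auto simp: Fract_conv_to_fract)
  have "to_fract (c * b) * f = to_fract (c * a)" using ab by simp
  moreover have "to_fract (c * b) * g \<in> range to_fract" if "g \<in> P" for g
  proof -
    obtain d where "to_fract c * g = to_fract d" using c(2)[OF \<open>g \<in> P\<close>] by blast
    then have "to_fract (c * b) * g = to_fract (d * b)" by (simp add: algebra_simps)
    then show ?thesis by blast
  qed
  ultimately show ?case
    using c(1) ab(2) by (intro exI[of _ "c * b"]) (auto simp del: to_fract_mult)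
qed

section \<open>Sweedler sums\<close>

lemma linear_formal_extend_commute:
  assumes "Vector_Spaces.linear s1 s2 f"
  shows "f (formal_extend s1 (\<lambda>(u, v). g u v) t) = formal_extend s2 (\<lambda>(u, v). f (g u v)) t"
proof -
  interpret f: Vector_Spaces.linear s1 s2 f by fact
  show ?thesis unfolding formal_extend_def by (simp add: f.sum f.scale split_def)
qed

lemma (in algebra_over) formal_extend_mult_left:
  "k * formal_extend scale (\<lambda>(u, v). g u v) t = formal_extend scale (\<lambda>(u, v). k * g u v) t"
  by (rule linear_formal_extend_commute)
    (simp add: Vector_Spaces.linear_iff vector_space_axioms distrib_left scale_mult_right)

lemma (in algebra_over) formal_extend_mult_right:
  "formal_extend scale (\<lambda>(u, v). g u v) t * k = formal_extend scale (\<lambda>(u, v). g u v * k) t"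
  by (rule linear_formal_extend_commute)
    (simp add: Vector_Spaces.linear_iff vector_space_axioms distrib_right scale_mult_left)

context vector_space
begin

text \<open>Turns nested formal sums, as in the coassociativity axiom, into iterated Sweedler
  sums.\<close>

lemma formal_extend_formal_extend:
  "formal_extend scale f (formal_extend formal_scale g t) =
   formal_extend scale (\<lambda>p. formal_extend scale f (g p)) t"
proof -
  interpret E: Vector_Spaces.linear formal_scale scale "formal_extend scale f"
    by (rule linear_formal_extend)
  show ?thesis by (simp add: formal_extend_def[of formal_scale] E.sum E.scale)
    (simp add: formal_extend_def)
qed

text \<open>A trilinear \<open>g\<close> sends every defining relation of the triple tensor product
  to zero, so its linear extension does not depend on representatives.\<close>

lemma formal_extend_tensor3_eq:
  assumes "\<And>v w. Vector_Spaces.linear sU scale (\<lambda>u. g u v w)"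
    and "\<And>u w. Vector_Spaces.linear sU scale (\<lambda>v. g u v w)"
    and "\<And>u v. Vector_Spaces.linear sU scale (\<lambda>w. g u v w)"
    and "tensor3_eq sU s t"
  shows "formal_extend scale (\<lambda>(u, v, w). g u v w) s = formal_extend scale (\<lambda>(u, v, w). g u v w) t"
proof -
  let ?E = "formal_extend scale (\<lambda>(u, v, w). g u v w)"
  interpret E: Vector_Spaces.linear formal_scale scale ?E by (rule linear_formal_extend)
  have lin: "g (u + u') v w = g u v w + g u' v w" "g (sU c u) v w = scale c (g u v w)"
    "g u (v + v') w = g u v w + g u v' w" "g u (sU c v) w = scale c (g u v w)"
    "g u v (w + w') = g u v w + g u v w'" "g u v (sU c w) = scale c (g u v w)" for u u' v v' w w' c
    using assms(1)[of v w] assms(2)[of u w] assms(3)[of u v]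
    by (auto simp: Vector_Spaces.linear_iff)
  have "?E x = 0" if "x \<in> tensor3_relations sU" for x
    using that unfolding tensor3_relations_def Let_def
    by (rule E.eq_0_on_span[rotated]) (auto simp: E.diff E.add E.scale lin)
  from this[of "s - t"] show ?thesis
    using assms(4) by (simp add: tensor3_eq_def E.diff)
qed

end

text \<open>Coassociativity as used in Sweedler calculus: a trilinear expression may be expanded at
  either leg of \<open>\<Delta> x\<close>.\<close>

lemma (in hopf_algebra) coassoc_formal_extend:
  assumes "vector_space sW"
    and "\<And>v w. Vector_Spaces.linear scale sW (\<lambda>u. g u v w)"
    and "\<And>u w. Vector_Spaces.linear scale sW (\<lambda>v. g u v w)"
    and "\<And>u v. Vector_Spaces.linear scale sW (\<lambda>w. g u v w)"
  shows "formal_extend sW (\<lambda>(y, z). formal_extend sW (\<lambda>(y1, y2). g y1 y2 z) (\<Delta> y)) (\<Delta> x) =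
         formal_extend sW (\<lambda>(y, z). formal_extend sW (\<lambda>(z1, z2). g y z1 z2) (\<Delta> z)) (\<Delta> x)"
proof -
  interpret W: vector_space sW by fact
  show ?thesis
    using W.formal_extend_tensor3_eq[OF assms(2-4) coassoc[of x]]
    by (simp add: W.formal_extend_formal_extend split_def)
qed

section \<open>Moving elements of the module algebra past the antipode\<close>

context smash_product
begin

text \<open>Commuting the first leg past \<open>a\<close> gives
  \<open>(x\<^sub>1 \<triangleright> a) x\<^sub>2 S(x\<^sub>3)\<close>, and the last two factors
  collapse to the counit. This exhibits the action as inner in the smash product.\<close>

lemma sum_\<iota>H_\<iota>A_antipode:
  "formal_extend scaleX (\<lambda>(y, z). \<iota>H y * \<iota>A a * \<iota>H (S z)) (\<Delta> x) = \<iota>A (act x a)"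
proof -
  note lin = Vector_Spaces.linear_iff \<iota>H.add \<iota>H.scale \<iota>A.add \<iota>A.scale distrib_left distrib_right
    \<iota>A.B.scale_mult_left \<iota>A.B.scale_mult_right vector_space_axioms \<iota>A.B.vector_space_axioms
  have S: "S (u + v) = S u + S v" "S (scaleH c u) = scaleH c (S u)" for u v c
    using antipode_linear by (simp_all add: Vector_Spaces.linear_iff)
  have act: "act (u + v) a = act u a + act v a" "act (scaleH c u) a = scaleA c (act u a)" for u v c
    using act_linear_left by (simp_all add: Vector_Spaces.linear_iff)
  have "formal_extend scaleX (\<lambda>(y, z). \<iota>H y * \<iota>A a * \<iota>H (S z)) (\<Delta> x) =
    formal_extend scaleX (\<lambda>(y, z). formal_extend scaleX
      (\<lambda>(y1, y2). \<iota>A (act y1 a) * \<iota>H y2 * \<iota>H (S z)) (\<Delta> y)) (\<Delta> x)"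
    by (simp add: smash_commute \<iota>A.B.formal_extend_mult_right)
  also have "\<dots> = formal_extend scaleX (\<lambda>(y, z). formal_extend scaleX
      (\<lambda>(z1, z2). \<iota>A (act y a) * \<iota>H z1 * \<iota>H (S z2)) (\<Delta> z)) (\<Delta> x)"
    by (rule coassoc_formal_extend) (simp_all add: lin S act)
  also have "\<dots> = formal_extend scaleX (\<lambda>(y, z). \<iota>A (act y a) * \<iota>H (scaleH (\<epsilon> z) 1)) (\<Delta> x)"
    by (simp add: antipode_right[symmetric] linear_formal_extend_commute[OF \<iota>H.linear_axioms]
        \<iota>A.B.formal_extend_mult_left \<iota>H.hom_mult mult.assoc)
  also have "\<dots> = formal_extend scaleX (\<lambda>(y, z). \<iota>A (act (scaleH (\<epsilon> z) y) a)) (\<Delta> x)"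
    by (simp add: \<iota>H.scale \<iota>A.scale \<iota>H.hom_one act \<iota>A.B.scale_mult_right)
  also have "\<dots> = \<iota>A (act (formal_extend scaleH (\<lambda>(y, z). scaleH (\<epsilon> z) y) (\<Delta> x)) a)"
    by (rule linear_formal_extend_commute[symmetric]) (simp add: lin act)
  finally show ?thesis by (simp only: counit_right)
qed

text \<open>In Sweedler notation both sides are
  \<open>S(x\<^sub>(\<^sub>1\<^sub>)) x\<^sub>(\<^sub>2\<^sub>) a S(x\<^sub>(\<^sub>3\<^sub>))\<close>. In this form moving \<open>a\<close> to the right of the Hopf algebra
  does not require the antimultiplicativity of the antipode or a formula for its inverse.\<close>

lemma \<iota>A_mult_antipode:
  "\<iota>A a * \<iota>H (S x) = formal_extend scaleX (\<lambda>(y, z). \<iota>H (S y) * \<iota>A (act z a)) (\<Delta> x)"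
proof -
  note lin = Vector_Spaces.linear_iff \<iota>H.add \<iota>H.scale \<iota>A.add \<iota>A.scale distrib_left distrib_right
    \<iota>A.B.scale_mult_left \<iota>A.B.scale_mult_right vector_space_axioms \<iota>A.B.vector_space_axioms
  have S: "S (u + v) = S u + S v" "S (scaleH c u) = scaleH c (S u)" for u v c
    using antipode_linear by (simp_all add: Vector_Spaces.linear_iff)
  \<comment> \<open>The preceding identity is read backwards, replacing
    \<open>x\<^sub>2 \<triangleright> a\<close> by \<open>x\<^sub>2 a S(x\<^sub>3)\<close>.\<close>
  have "formal_extend scaleX (\<lambda>(y, z). \<iota>H (S y) * \<iota>A (act z a)) (\<Delta> x) =
    formal_extend scaleX (\<lambda>(y, z). formal_extend scaleX
      (\<lambda>(z1, z2). \<iota>H (S y) * \<iota>H z1 * \<iota>A a * \<iota>H (S z2)) (\<Delta> z)) (\<Delta> x)"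
    by (simp add: sum_\<iota>H_\<iota>A_antipode[symmetric] \<iota>A.B.formal_extend_mult_left mult.assoc)
  \<comment> \<open>After regrouping, \<open>S(x\<^sub>1) x\<^sub>2\<close> comes from a single
    comultiplication and the antipode axiom removes it.\<close>
  also have "\<dots> = formal_extend scaleX (\<lambda>(y, z). formal_extend scaleX
      (\<lambda>(y1, y2). \<iota>H (S y1) * \<iota>H y2 * \<iota>A a * \<iota>H (S z)) (\<Delta> y)) (\<Delta> x)"
    by (rule coassoc_formal_extend[symmetric]) (simp_all add: lin S)
  also have "\<dots> = formal_extend scaleX (\<lambda>(y, z). \<iota>H (scaleH (\<epsilon> y) 1) * \<iota>A a * \<iota>H (S z)) (\<Delta> x)"
    by (simp add: antipode_left[symmetric] linear_formal_extend_commute[OF \<iota>H.linear_axioms]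
        \<iota>A.B.formal_extend_mult_right \<iota>H.hom_mult)
  also have "\<dots> = formal_extend scaleX (\<lambda>(y, z). \<iota>A a * \<iota>H (S (scaleH (\<epsilon> y) z))) (\<Delta> x)"
    by (simp add: \<iota>H.scale \<iota>H.hom_one S \<iota>A.B.scale_mult_left \<iota>A.B.scale_mult_right)
  also have "\<dots> = \<iota>A a * \<iota>H (S (formal_extend scaleH (\<lambda>(y, z). scaleH (\<epsilon> y) z) (\<Delta> x)))"
    by (rule linear_formal_extend_commute[symmetric]) (simp add: lin S)
  finally show ?thesis by (simp only: counit_left)
qed

end

section \<open>Smash products and Galois orders\<close>

context smash_product
begin

lemma linear_smash_map: "Vector_Spaces.linear formal_scale scaleX (smash_map scaleX \<iota>A \<iota>H)"
  unfolding smash_map_def by (rule \<iota>A.B.linear_formal_extend)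

text \<open>Left multiplication acts on representatives through the first tensor factor, which makes
  \<open>smash_hat\<close> left linear over the module algebra.\<close>

lemma \<iota>A_mult_smash_map:
  "\<iota>A f * smash_map scaleX \<iota>A \<iota>H t =
   smash_map scaleX \<iota>A \<iota>H
     (formal_extend formal_scale (\<lambda>(a, x). Poly_Mapping.single (f * a, x) 1) t)"
  by (simp add: smash_map_def \<iota>A.B.formal_extend_formal_extend \<iota>A.hom_mult split_def mult.assoc
      \<iota>A.B.formal_extend_mult_left[where g = "\<lambda>a x. \<iota>A a * \<iota>H x", unfolded split_def])

lemma smash_hat_add:
  "smash_hat scaleA act scaleX \<iota>A \<iota>H (X + Y) g =
   smash_hat scaleA act scaleX \<iota>A \<iota>H X g + smash_hat scaleA act scaleX \<iota>A \<iota>H Y g"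
proof -
  obtain s t where st: "X = smash_map scaleX \<iota>A \<iota>H s" "Y = smash_map scaleX \<iota>A \<iota>H t"
    using smash_map_surj by (metis surjD)
  interpret m: Vector_Spaces.linear formal_scale scaleX "smash_map scaleX \<iota>A \<iota>H"
    by (rule linear_smash_map)
  interpret E: Vector_Spaces.linear formal_scale scaleA "formal_extend scaleA (\<lambda>(a, x). a * act x g)"
    by (rule A.linear_formal_extend)
  show ?thesis by (simp add: st m.add[symmetric] smash_hat_smash_map E.add)
qed

lemma smash_hat_\<iota>A_mult:
  "smash_hat scaleA act scaleX \<iota>A \<iota>H (\<iota>A f * X) g = f * smash_hat scaleA act scaleX \<iota>A \<iota>H X g"
proof -
  obtain t where t: "X = smash_map scaleX \<iota>A \<iota>H t"
    using smash_map_surj by (metis surjD)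
  show ?thesis
    by (simp add: t \<iota>A_mult_smash_map smash_hat_smash_map A.formal_extend_formal_extend
        A.formal_extend_mult_left[where g = "\<lambda>a x. a * act x g", unfolded split_def]
        split_def mult.assoc)
qed

text \<open>For arbitrary sets \<open>B\<close> and \<open>K\<close>, formal sums supported on
  \<open>B \<times> K\<close> are closed under the linear operations, and \<open>smash_map\<close>
  is linear.\<close>

lemma subspace_smash_subset: "\<iota>A.B.subspace (smash_subset scaleX \<iota>A \<iota>H B K)"
proof -
  interpret m: Vector_Spaces.linear formal_scale scaleX "smash_map scaleX \<iota>A \<iota>H"
    by (rule linear_smash_map)
  have "m.vs1.subspace {t :: 'a \<times> 'h \<Rightarrow>\<^sub>0 'k. Poly_Mapping.keys t \<subseteq> B \<times> K}"
  proof (rule m.vs1.subspaceI)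
    fix s t :: "'a \<times> 'h \<Rightarrow>\<^sub>0 'k" and c
    show "s + t \<in> {t. Poly_Mapping.keys t \<subseteq> B \<times> K}"
      if "s \<in> {t. Poly_Mapping.keys t \<subseteq> B \<times> K}" "t \<in> {t. Poly_Mapping.keys t \<subseteq> B \<times> K}"
      using that keys_add[of s t] by blast
    show "formal_scale c t \<in> {t. Poly_Mapping.keys t \<subseteq> B \<times> K}"
      if "t \<in> {t. Poly_Mapping.keys t \<subseteq> B \<times> K}"
      using that by (auto simp: in_keys_iff)
  qed auto
  then show ?thesis unfolding smash_subset_def by (rule m.subspace_image)
qed

lemma \<iota>A_mult_\<iota>H_in_smash_subset:
  assumes "b \<in> B" "h \<in> K"
  shows "\<iota>A b * \<iota>H h \<in> smash_subset scaleX \<iota>A \<iota>H B K"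
  unfolding smash_subset_def
  by (rule image_eqI[where x = "Poly_Mapping.single (b, h) 1"]) (use assms in \<open>auto simp: smash_map_def\<close>)

end

section \<open>Left and right module structures on the smash product of a setting\<close>

context hopf_galois_setting
begin

abbreviation hat :: "'s \<Rightarrow> 'a fract \<Rightarrow> 'a fract" where
  "hat \<equiv> smash_hat (fract_scale scale\<Lambda>) actL scaleX \<iota>L \<iota>H"

lemma vector_space_left: "vector_space (\<lambda>f X. \<iota>L f * X)"
  by unfold_locales (simp_all add: algebra_simps \<iota>A.add \<iota>A.hom_mult \<iota>A.hom_one)

text \<open>Commutativity of \<open>L\<close> lets right multiplication satisfy the axioms of a left
  scalar action.\<close>

lemma vector_space_right: "vector_space (\<lambda>f X. X * \<iota>L f)"
  by unfold_locales
    (simp_all add: algebra_simps \<iota>A.add \<iota>A.hom_mult[symmetric] \<iota>A.hom_one mult.commute)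

lemma module_left: "module (\<lambda>a X. \<iota>L (to_fract a) * X)"
  by unfold_locales (simp_all add: algebra_simps \<iota>A.add \<iota>A.hom_mult \<iota>A.hom_one)

lemma module_right: "module (\<lambda>a X. X * \<iota>L (to_fract a))"
  by unfold_locales
    (simp_all add: algebra_simps \<iota>A.add \<iota>A.hom_mult[symmetric] \<iota>A.hom_one mult.commute)

interpretation left_L: vector_space "\<lambda>f X. \<iota>L f * X" by (rule vector_space_left)
interpretation right_L: vector_space "\<lambda>f X. X * \<iota>L f" by (rule vector_space_right)
interpretation left_\<Lambda>: module "\<lambda>a X. \<iota>L (to_fract a) * X" by (rule module_left)
interpretation right_\<Lambda>: module "\<lambda>a X. X * \<iota>L (to_fract a)" by (rule module_right)

lemma \<iota>L_scale: "\<iota>L (to_fract (scale\<Lambda> c 1)) = scaleX c 1"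
  using \<iota>A.scale[of c 1] by (simp add: fract_scale_def \<iota>A.hom_one)

text \<open>Scalars of the ground field are central elements coming from \<open>\<Lambda>\<close>,
  so here and in the next lemma they are absorbed into \<open>\<Lambda>\<close>-coefficients on
  either side.\<close>

lemma scaleX_eq_left: "scaleX c X = \<iota>L (to_fract (scale\<Lambda> c 1)) * X"
  by (simp add: \<iota>L_scale \<iota>A.B.scale_mult_left)

lemma scaleX_eq_right: "scaleX c X = X * \<iota>L (to_fract (scale\<Lambda> c 1))"
  by (simp add: \<iota>L_scale \<iota>A.B.scale_mult_right)

lemma linear_hat: "Vector_Spaces.linear (\<lambda>f X. \<iota>L f * X) (*) (\<lambda>X. hat X g)"
  by unfold_locales (simp_all add: smash_hat_add smash_hat_\<iota>A_mult algebra_simps)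

text \<open>Faithfulness concerns only \<open>\<Lambda> # H\<close>. A common denominator
  \<open>c\<close> of the coefficients of a representative moves \<open>X\<close> there; by left
  linearity \<open>c X\<close> still annihilates \<open>\<Lambda>\<close>, and \<open>c\<close> is
  invertible in \<open>L\<close>.\<close>

lemma hat_eq_0_imp_eq_0:
  assumes X: "X \<in> smash_subset scaleX \<iota>L \<iota>H UNIV H" and hat: "\<And>a. hat X (to_fract a) = 0"
  shows "X = 0"
proof -
  obtain t where t: "X = smash_map scaleX \<iota>L \<iota>H t" "Poly_Mapping.keys t \<subseteq> UNIV \<times> H"
    using X unfolding smash_subset_def by blast
  obtain c where c: "c \<noteq> 0" "\<And>f. f \<in> fst ` Poly_Mapping.keys t \<Longrightarrow> to_fract c * f \<in> range to_fract"
    using common_denominator[of "fst ` Poly_Mapping.keys t"] by auto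
  let ?X = "\<iota>L (to_fract c) * X"
  have eq: "?X = (\<Sum>p\<in>Poly_Mapping.keys t. scaleX (Poly_Mapping.lookup t p)
      (\<iota>L (to_fract c * fst p) * \<iota>H (snd p)))"
    unfolding t(1) smash_map_def formal_extend_def
    by (simp add: sum_distrib_left \<iota>A.B.scale_mult_right split_def)
  have "?X \<in> smash_subset scaleX \<iota>L \<iota>H (range to_fract) H"
    unfolding eq
  proof (intro \<iota>A.B.subspace_sum[OF subspace_smash_subset]
      \<iota>A.B.subspace_scale[OF subspace_smash_subset] \<iota>A_mult_\<iota>H_in_smash_subset)
    fix p assume "p \<in> Poly_Mapping.keys t"
    then show "to_fract c * fst p \<in> range to_fract" "snd p \<in> H" using c(2) t(2) by auto
  qed
  then have "?X = 0" by (rule faithful) (simp add: smash_hat_\<iota>A_mult hat)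
  then show ?thesis using left_L.scale_eq_0_iff c(1) by simp
qed

text \<open>The functionals are evaluations at elements of \<open>\<Lambda>\<close>: integral on
  \<open>F\<close> by the order axiom, separating by faithfulness. Only elements of \<open>M\<close>
  must be separated, so \<open>B\<close> may leave \<open>L # H\<close>, as happens in the
  right-hand case.\<close>

lemma finitely_generated_in_order_left:
  assumes F: "galois_order H scale\<Lambda> actL scaleX \<iota>L \<iota>H F"
    and M: "left_\<Lambda>.subspace M" "M \<subseteq> F" "M \<subseteq> left_L.span B" and "finite B"
  shows "finitely_generated (\<lambda>a X. \<iota>L (to_fract a) * X) M"
proof (rule left_L.finitely_generated_lattice[where \<iota> = to_fract
      and \<phi> = "\<lambda>a X. hat X (to_fract a)"])
  show "hat X (to_fract a) \<in> range to_fract" if "X \<in> M" for a X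
    using that M(2) F unfolding galois_order_def by blast
  show "X = 0" if "X \<in> M" "\<And>a. hat X (to_fract a) = 0" for X
    using hat_eq_0_imp_eq_0[OF _ that(2)] that(1) M(2) F unfolding galois_order_def by blast
qed (use assms noetherian_\<Lambda> linear_hat in auto)

text \<open>In \<open>x f = (x\<^sub>1 \<triangleright> f) x\<^sub>2\<close> the element
  \<open>f\<close> enters only the left coefficients, so the second legs give a \<open>D\<close>
  independent of \<open>f\<close>.\<close>

lemma mult_\<iota>L_in_left_span:
  "\<exists>D. finite D \<and> (\<forall>f. X * \<iota>L f \<in> left_L.span D)"
proof -
  obtain t where t: "X = smash_map scaleX \<iota>L \<iota>H t"
    using smash_map_surj by (metis surjD)
  define D where "D = (\<Union>p\<in>Poly_Mapping.keys t. \<iota>H ` snd ` Poly_Mapping.keys (\<Delta> (snd p)))"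
  have "\<iota>H (snd p) * \<iota>L f \<in> left_L.span D" if "p \<in> Poly_Mapping.keys t" for p f
    unfolding smash_commute formal_extend_def split_def scaleX_eq_left
    by (intro left_L.span_sum left_L.span_scale left_L.span_base) (use that in \<open>auto simp: D_def\<close>)
  then have "X * \<iota>L f \<in> left_L.span D" for f
    unfolding t smash_map_def formal_extend_def split_def scaleX_eq_left sum_distrib_right mult.assoc
    by (intro left_L.span_sum left_L.span_scale)
  moreover have "finite D" by (simp add: D_def)
  ultimately show ?thesis by blast
qed

lemma right_span_subset_left_span:
  assumes "finite B"
  shows "\<exists>D. finite D \<and> right_L.span B \<subseteq> left_L.span D"
proof -
  obtain D where D: "\<And>X. finite (D X)" "\<And>X f. X * \<iota>L f \<in> left_L.span (D X)"
    using mult_\<iota>L_in_left_span by metis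
  have "x \<in> left_L.span (\<Union>(D ` B))" if "x \<in> right_L.span B" for x
    using that
  proof (induction rule: right_L.span_induct_alt)
    case base
    show ?case by (rule left_L.span_zero)
  next
    case (step f b y)
    have "left_L.span (D b) \<subseteq> left_L.span (\<Union>(D ` B))"
      using step(1) by (intro left_L.span_mono) auto
    with D(2) show ?case using step(2) by (intro left_L.span_add) auto
  qed
  then show ?thesis using assms D(1) by (intro exI[of _ "\<Union>(D ` B)"]) auto
qed

text \<open>Writing \<open>h = S x\<close>, the formula
  \<open>a S(x) = S(x\<^sub>1) (x\<^sub>2 \<triangleright> a)\<close> has right coefficients in
  \<open>\<Lambda>\<close>, since the action preserves \<open>\<Lambda>\<close>, and generators
  \<open>S(x\<^sub>1)\<close> independent of \<open>a\<close>.\<close>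

lemma \<iota>L_mult_\<iota>H_in_right_span:
  "\<exists>E. finite E \<and> (\<forall>a. \<iota>L (to_fract a) * \<iota>H h \<in> right_\<Lambda>.span E)"
proof -
  obtain x where x: "h = S x" using antipode_bij by (metis bij_pointE)
  define E where "E = \<iota>H ` S ` fst ` Poly_Mapping.keys (\<Delta> x)"
  have "\<iota>L (to_fract a) * \<iota>H h \<in> right_\<Lambda>.span E" for a
    unfolding x \<iota>A_mult_antipode formal_extend_def split_def scaleX_eq_right actL_extends
    by (intro right_\<Lambda>.span_sum right_\<Lambda>.span_scale right_\<Lambda>.span_base) (auto simp: E_def)
  moreover have "finite E" by (simp add: E_def)
  ultimately show ?thesis by blast
qed

lemma in_left_\<Lambda>_span_products:
  "\<exists>G. finite G \<and> G \<subseteq> {\<iota>L f * \<iota>H h | f h. True} \<and> X \<in> left_\<Lambda>.span G"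
proof -
  obtain t where t: "X = smash_map scaleX \<iota>L \<iota>H t"
    using smash_map_surj by (metis surjD)
  let ?G = "(\<lambda>p. \<iota>L (fst p) * \<iota>H (snd p)) ` Poly_Mapping.keys t"
  have "X \<in> left_\<Lambda>.span ?G"
    unfolding t smash_map_def formal_extend_def split_def scaleX_eq_left
    by (intro left_\<Lambda>.span_sum left_\<Lambda>.span_scale left_\<Lambda>.span_base) auto
  then show ?thesis by (intro exI[of _ ?G]) auto
qed

text \<open>Induction on \<open>G\<close>: a denominator \<open>d\<close> of \<open>f\<close> moves
  \<open>\<Lambda> f h\<close> into \<open>\<Lambda> h\<close>, which is bounded on the right by the
  antipode formula. Denominators multiply along the way.\<close>

lemma products_right_bounded:
  assumes "finite G" "G \<subseteq> {\<iota>L f * \<iota>H h | f h. True}"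
  shows "\<exists>c E. c \<noteq> 0 \<and> finite E \<and>
    (\<forall>X\<in>left_\<Lambda>.span G. \<iota>L (to_fract c) * X \<in> right_\<Lambda>.span E)"
  using assms
proof (induction G)
  case empty
  show ?case by (intro exI[of _ 1] exI[of _ "{}"]) simp
next
  case (insert g G)
  then obtain c E where c: "c \<noteq> 0" and E: "finite E"
    and cE: "\<And>X. X \<in> left_\<Lambda>.span G \<Longrightarrow> \<iota>L (to_fract c) * X \<in> right_\<Lambda>.span E"
    by auto
  obtain f h where g: "g = \<iota>L f * \<iota>H h" using insert.prems by blast
  obtain d b where d: "d \<noteq> 0" "to_fract d * f = to_fract b"
    using common_denominator[of "{f}"] by auto
  obtain E' where E': "finite E'" "\<And>a. \<iota>L (to_fract a) * \<iota>H h \<in> right_\<Lambda>.span E'"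
    using \<iota>L_mult_\<iota>H_in_right_span by blast
  have "\<iota>L (to_fract (c * d)) * X \<in> right_\<Lambda>.span (E \<union> E')" if "X \<in> left_\<Lambda>.span (insert g G)" for X
  proof -
    obtain k where k: "X - \<iota>L (to_fract k) * g \<in> left_\<Lambda>.span G"
      using \<open>X \<in> _\<close> left_\<Lambda>.span_breakdown_eq by blast
    define Y where "Y = X - \<iota>L (to_fract k) * g"
    have "to_fract (c * d) * (to_fract k * f) = to_fract (c * k) * (to_fract d * f)"
      by (simp add: algebra_simps)
    also have "\<dots> = to_fract (c * k * b)" using d by simp
    finally have eq: "\<iota>L (to_fract (c * d)) * (\<iota>L (to_fract k) * g) = \<iota>L (to_fract (c * k * b)) * \<iota>H h"
      unfolding g mult.assoc[symmetric] \<iota>A.hom_mult[symmetric] by (simp add: mult.assoc)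
    have X: "X = Y + \<iota>L (to_fract k) * g" by (simp add: Y_def)
    have "\<iota>L (to_fract (c * d)) * X =
      \<iota>L (to_fract c) * (\<iota>L (to_fract d) * Y) + \<iota>L (to_fract (c * k * b)) * \<iota>H h"
      by (simp only: X eq[symmetric] distrib_left left_\<Lambda>.scale_scale)
    \<comment> \<open>The factor \<open>d\<close> is applied first and keeps \<open>Y\<close> in the
      left span of \<open>G\<close>, where multiplication by \<open>c\<close> is controlled.\<close>
    moreover have "\<iota>L (to_fract c) * (\<iota>L (to_fract d) * Y) \<in> right_\<Lambda>.span (E \<union> E')"
      using cE[OF left_\<Lambda>.span_scale[OF k]] right_\<Lambda>.span_mono[of E "E \<union> E'"] unfolding Y_def by blast
    moreover have "\<iota>L (to_fract (c * k * b)) * \<iota>H h \<in> right_\<Lambda>.span (E \<union> E')"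
      using E'(2) right_\<Lambda>.span_mono[of E' "E \<union> E'"] by blast
    ultimately show ?thesis by (simp only: right_\<Lambda>.span_add)
  qed
  then show ?case
    using c d(1) E E'(1) by (intro exI[of _ "c * d"] exI[of _ "E \<union> E'"]) (auto simp del: to_fract_mult)
qed

text \<open>Each generator is a \<open>\<Lambda>\<close>-combination of finitely many products
  \<open>f h\<close>, so the bound for products applies.\<close>

lemma left_finitely_generated_right_bounded:
  assumes "finitely_generated (\<lambda>a X. \<iota>L (to_fract a) * X) M"
  shows "\<exists>c E. c \<noteq> 0 \<and> finite E \<and> (\<lambda>X. \<iota>L (to_fract c) * X) ` M \<subseteq> right_\<Lambda>.span E"
proof -
  obtain B where B: "finite B" "M = left_\<Lambda>.span B"
    using assms unfolding finitely_generated_def by blast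
  obtain G where G: "\<And>X. finite (G X)" "\<And>X. G X \<subseteq> {\<iota>L f * \<iota>H h | f h. True}"
    "\<And>X. X \<in> left_\<Lambda>.span (G X)"
    using in_left_\<Lambda>_span_products by metis
  have "B \<subseteq> left_\<Lambda>.span (\<Union>(G ` B))"
    using G(3) left_\<Lambda>.span_mono[of "G b" "\<Union>(G ` B)" for b] by blast
  then have "M \<subseteq> left_\<Lambda>.span (\<Union>(G ` B))"
    unfolding B(2) by (rule left_\<Lambda>.span_minimal) simp
  moreover obtain c E where "c \<noteq> 0" "finite E"
    "\<And>X. X \<in> left_\<Lambda>.span (\<Union>(G ` B)) \<Longrightarrow> \<iota>L (to_fract c) * X \<in> right_\<Lambda>.span E"
    using products_right_bounded[of "\<Union>(G ` B)"] B(1) G(1,2) by blast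
  ultimately show ?thesis by blast
qed

section \<open>The intersections \<open>V \<inter> F\<close>\<close>

lemma order_subspaces:
  assumes F: "galois_order H scale\<Lambda> actL scaleX \<iota>L \<iota>H F"
  shows "left_\<Lambda>.subspace F" "right_\<Lambda>.subspace F"
proof -
  have "\<iota>A.B.subspace F" and mult: "\<And>X Y. X \<in> F \<Longrightarrow> Y \<in> F \<Longrightarrow> X * Y \<in> F"
    and "\<And>a. \<iota>L (to_fract a) \<in> F"
    using F unfolding galois_order_def subalgebra_def by auto
  then show "left_\<Lambda>.subspace F" "right_\<Lambda>.subspace F"
    using \<iota>A.B.subspace_0 \<iota>A.B.subspace_add
    by (auto intro!: left_\<Lambda>.subspaceI right_\<Lambda>.subspaceI)
qed

lemma subspaces_restrict:
  "left_L.subspace V \<Longrightarrow> left_\<Lambda>.subspace V" "right_L.subspace V \<Longrightarrow> right_\<Lambda>.subspace V"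
  by (simp_all add: left_L.subspace_def left_\<Lambda>.subspace_def right_L.subspace_def right_\<Lambda>.subspace_def)

lemma finitely_generated_left:
  assumes F: "galois_order H scale\<Lambda> actL scaleX \<iota>L \<iota>H F"
    and V: "finite_dim_subspace (\<lambda>f X. \<iota>L f * X) V"
  shows "finitely_generated (\<lambda>a X. \<iota>L (to_fract a) * X) (V \<inter> F)"
proof -
  obtain B where B: "finite B" "V = left_L.span B"
    using V unfolding finite_dim_subspace_def by blast
  show ?thesis
    by (rule finitely_generated_in_order_left[OF F _ _ _ B(1)])
      (simp_all add: B(2) left_\<Lambda>.subspace_inter subspaces_restrict order_subspaces[OF F])
qed

lemma finitely_generated_right:
  assumes F: "galois_order H scale\<Lambda> actL scaleX \<iota>L \<iota>H F"
    and V: "finite_dim_subspace (\<lambda>f X. X * \<iota>L f) V"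
  shows "finitely_generated (\<lambda>a X. X * \<iota>L (to_fract a)) (V \<inter> F)"
proof -
  obtain B where B: "finite B" "V = right_L.span B"
    using V unfolding finite_dim_subspace_def by blast
  \<comment> \<open>Enlarging \<open>V\<close> to a left subspace makes the left-hand result
    available for a module containing \<open>V \<inter> F\<close>.\<close>
  obtain D where D: "finite D" "V \<subseteq> left_L.span D"
    using right_span_subset_left_span B by blast
  have "finitely_generated (\<lambda>a X. \<iota>L (to_fract a) * X) (left_L.span D \<inter> F)"
    by (rule finitely_generated_in_order_left[OF F _ _ _ D(1)])
      (simp_all add: left_\<Lambda>.subspace_inter subspaces_restrict order_subspaces[OF F])
  then obtain c E where c: "c \<noteq> 0" and E: "finite E"
    and cE: "(\<lambda>X. \<iota>L (to_fract c) * X) ` (left_L.span D \<inter> F) \<subseteq> right_\<Lambda>.span E"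
    using left_finitely_generated_right_bounded by blast
  let ?c = "\<lambda>X. \<iota>L (to_fract c) * X"
  have N: "right_\<Lambda>.subspace (V \<inter> F)"
    by (simp add: B(2) right_\<Lambda>.subspace_inter subspaces_restrict order_subspaces[OF F])
  \<comment> \<open>Left multiplication by \<open>c\<close> commutes with the right action by
    associativity; it is injective because \<open>c\<close> is invertible in
    \<open>L\<close>.\<close>
  have hom: "module_hom (\<lambda>a X. X * \<iota>L (to_fract a)) (\<lambda>a X. X * \<iota>L (to_fract a)) ?c"
    by unfold_locales (simp_all add: distrib_left mult.assoc)
  interpret c: module_hom "\<lambda>a X. X * \<iota>L (to_fract a)" "\<lambda>a X. X * \<iota>L (to_fract a)" ?c
    by (rule hom)
  have "inj ?c" using c by (auto intro!: injI)
  moreover have "finitely_generated (\<lambda>a X. X * \<iota>L (to_fract a)) (?c ` (V \<inter> F))"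
    using noetherian_\<Lambda> E c.subspace_image[OF N]
    by (rule right_\<Lambda>.finitely_generated_submodule) (use cE D(2) in blast)
  ultimately show ?thesis
    using right_\<Lambda>.finitely_generated_inj_image[OF hom] N by blast
qed

end

theorem theorem3p18:
  fixes scaleH :: "'k::field \<Rightarrow> 'h::ring_1 \<Rightarrow> 'h"
    and \<Delta> :: "'h \<Rightarrow> ('h \<times> 'h \<Rightarrow>\<^sub>0 'k)"
    and \<epsilon> :: "'h \<Rightarrow> 'k"
    and S :: "'h \<Rightarrow> 'h"
    and H :: "'h set"
    and scale\<Lambda> :: "'k \<Rightarrow> 'a::idom \<Rightarrow> 'a"
    and act :: "'h \<Rightarrow> 'a \<Rightarrow> 'a"
    and actL :: "'h \<Rightarrow> 'a fract \<Rightarrow> 'a fract"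
    and scaleX :: "'k \<Rightarrow> 's::ring_1 \<Rightarrow> 's"
    and \<iota>L :: "'a fract \<Rightarrow> 's"
    and \<iota>H :: "'h \<Rightarrow> 's"
    and F V :: "'s set"
  assumes "hopf_galois_setting scaleH \<Delta> \<epsilon> S H scale\<Lambda> act actL scaleX \<iota>L \<iota>H"
    and "galois_order H scale\<Lambda> actL scaleX \<iota>L \<iota>H F"
    and "V \<subseteq> smash_subset scaleX \<iota>L \<iota>H UNIV H"
  shows "(finite_dim_subspace (\<lambda>f X. \<iota>L f * X) V \<longrightarrow>
            finitely_generated (\<lambda>a X. \<iota>L (to_fract a) * X) (V \<inter> F)) \<and>
         (finite_dim_subspace (\<lambda>f X. X * \<iota>L f) V \<longrightarrow>
            finitely_generated (\<lambda>a X. X * \<iota>L (to_fract a)) (V \<inter> F))"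
proof -
  interpret hopf_galois_setting scaleH \<Delta> \<epsilon> S H scale\<Lambda> act actL scaleX \<iota>L \<iota>H
    by (rule assms(1))
  show ?thesis
    using finitely_generated_left[OF assms(2)] finitely_generated_right[OF assms(2)] by blast
qed

end
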